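(* Let $\mathcal N=\{1,\dots,n\}$, and consider arrival probabilities $\lambda_1,\dots,\lambda_n$, revenues $r_1\ge\cdots\ge r_n$ and homogeneous transition weights $v_0,v_1,\dots,v_n\ge 0$ with $\sum_{i=0}^n v_i=1$. Consider the homogeneous MCST model and the Markov chain choice model with these same arrival probabilities $\lambda_i$, revenues $r_i$ and transition probabilities $v_{ji}=v_i$ ($j\in\mathcal N$, $i\in\mathcal N\cup\{0\}$). If $S^*\subseteq\mathcal N$ is an optimal assortment under the Markov chain choice model, then offering $S^*$ and recommending $R_j=S^*$ for each $j\in\mathcal N\setminus S^*$ is an optimal solution to the homogeneous MCST problem. Furthermore, the optimal values of the two assortment optimization problems are the same.
   Context: Products are $\mathcal N=\{1,\dots,n\}$; $0$ denotes the no-purchase option. Product $j$ has revenue $r_j$ (a real number), sorted so that $r_1\ge r_2\ge\cdots\ge r_n$. Arrival probabilities satisfy $\lambda_j\ge0$, $\sum_{j=1}^n\lambda_j=1$. Homogeneous MCST problem: the seller chooses an offered assortment $S\subseteq\mathcal N$ and, for each $j\in\mathcal N\setminus S$, a recommended set $R_j\subseteq S$. A customer arrives at product $j$ with probability $\lambda_j$; if $j\in S$ the customer buys $j$; if $j\notin S$ the customer buys $i\in R_j$ with probability $v_i/(\sum_{k\in R_j}v_k+v_0)$ and otherwise leaves. The problem is to choose $S$ and $\{R_j\}_{j\notin S}$ maximizing the expected revenue $$\mathbf R(S,\{R_j\}_{j\notin S})=\sum_{i\in S}\lambda_i r_i+\sum_{j\notin S}\lambda_j\frac{\sum_{i\in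 R_j}r_iv_i}{\sum_{i\in R_j}v_i+v_0},$$ with the convention $0/0=0$. Markov chain choice model: the seller chooses only $S\subseteq\mathcal N$. A customer arrives at product $j$ with probability $\lambda_j$. Whenever the customer is at a product in $S$, the customer buys it and the process stops. Whenever the customer is at a product $j\in\mathcal N\setminus S$, the customer moves to $i\in\mathcal N\cup\{0\}$ with probability $v_{ji}$ (here $v_{ji}=v_i$), and the process stops without purchase upon reaching $0$; otherwise it continues. The assortment optimization problem under this model is to choose $S$ maximizing $\sum_{i\in S}r_i\,\mathrm{Pr}^M_i(S)$, where $\mathrm{Pr}^M_i(S)$ is the probability that the customer eventually buys $i$; a maximizer is an optimal assortment. *)

theory Defs
  imports "HOL-Probability.Probability"
begin

text \<open>
  Products are \<open>{1..n}\<close> and \<open>0\<close> is the no-purchase option, so weights and transition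
  probabilities have indices in \<open>{0..n}\<close>.  Values outside these ranges are irrelevant.
\<close>

section \<open>Trajectories of a Markov chain\<close>

definition chain_kernel :: "'a pmf \<Rightarrow> ('a \<Rightarrow> 'a pmf) \<Rightarrow> nat \<Rightarrow> (nat \<Rightarrow> 'a) \<Rightarrow> 'a measure" where
  "chain_kernel I K t \<omega> = measure_pmf (case t of 0 \<Rightarrow> I | Suc s \<Rightarrow> K (\<omega> s))"

text \<open>
  The law of the trajectory \<open>(X 0, X 1, \<dots>)\<close> with initial distribution \<open>I\<close> and transition
  kernel \<open>K\<close>, as the Ionescu-Tulcea extension.  The lemma \<open>chain_law_cylinder\<close> below
  characterises it by its finite-dimensional distributions.
\<close>

definition chain_law ::
    "'a pmf \<Rightarrow> ('a \<Rightarrow> 'a pmf) \<Rightarrow> (nat \<Rightarrow> 'a) measure" where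
  "chain_law I K =
     projective_family.lim UNIV
       (Ionescu_Tulcea.CI (chain_kernel I K) (\<lambda>_. count_space UNIV)) (\<lambda>_. count_space UNIV)"

lemma Ionescu_Tulcea_chain:
  fixes I :: "'a pmf"
  shows "Ionescu_Tulcea (chain_kernel I K) (\<lambda>_. count_space UNIV)"
proof (rule Ionescu_Tulcea.intro)
  fix t :: nat
  show "chain_kernel I K t \<in> PiM {0..<t} (\<lambda>_. count_space UNIV) \<rightarrow>\<^sub>M subprob_algebra (count_space UNIV)"
  proof (cases t)
    case 0
    then show ?thesis
      by (simp add: chain_kernel_def[abs_def] measure_pmf_in_subprob_algebra)
  next
    case (Suc s)
    have "(\<lambda>j. measure_pmf (K j)) \<in> count_space UNIV \<rightarrow>\<^sub>M subprob_algebra (count_space UNIV)"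
      by (simp add: measure_pmf_in_subprob_algebra)
    moreover have "(\<lambda>\<omega>. \<omega> s) \<in> PiM {0..<t} (\<lambda>_. count_space UNIV) \<rightarrow>\<^sub>M count_space UNIV"
      using Suc by (intro measurable_component_singleton) auto
    ultimately show ?thesis
      unfolding chain_kernel_def[abs_def] Suc by (auto intro: measurable_compose)
  qed
next
  fix t :: nat and \<omega>
  assume "\<omega> \<in> space (PiM {0..<t} (\<lambda>_. count_space (UNIV :: 'a set)))"
  show "prob_space (chain_kernel I K t \<omega>)"
    by (simp add: chain_kernel_def measure_pmf.prob_space_axioms)
qed

lemma sets_chain_law: "sets (chain_law I K) = sets (PiM UNIV (\<lambda>_. count_space UNIV))"
proof -
  interpret Ionescu_Tulcea "chain_kernel I K" "\<lambda>_. count_space UNIV"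
    by (rule Ionescu_Tulcea_chain)
  show ?thesis by (simp add: chain_law_def)
qed

lemma space_chain_law: "space (chain_law I K) = UNIV"
  using sets_eq_imp_space_eq[OF sets_chain_law[of I K]] by (simp add: space_PiM)

lemma chain_law_cylinder:
  fixes I :: "'a pmf"
  shows "emeasure (chain_law I K) {\<omega>. \<forall>s\<le>t. \<omega> s = x s} =
           ennreal (pmf I (x 0) * (\<Prod>s<t. pmf (K (x s)) (x (Suc s))))"
proof -
  interpret IT: Ionescu_Tulcea "chain_kernel I K" "\<lambda>_. count_space UNIV"
    by (rule Ionescu_Tulcea_chain)
  let ?M = "\<lambda>_::nat. count_space (UNIV :: 'a set)"
  let ?x = "\<lambda>m. restrict x {0..<m}"
  have sp: "?x m \<in> space (PiM {0..<m} ?M)" for m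
    by (auto simp: space_PiM)
  have meas: "{?x m} \<in> sets (PiM {0..<m} ?M)" for m
  proof -
    have "{?x m} = PiE {0..<m} (\<lambda>i. {x i})"
      by (auto simp: PiE_iff extensional_def restrict_def fun_eq_iff)
    then show ?thesis by (auto intro!: sets_PiM_I_finite)
  qed
  have step: "emeasure (IT.C 0 (Suc m) (\<lambda>_. undefined)) {?x (Suc m)} =
      emeasure (IT.C 0 m (\<lambda>_. undefined)) {?x m} * emeasure (chain_kernel I K m (?x m)) {x m}" for m
  proof -
    have u: "(\<lambda>_. undefined) \<in> space (PiM {0..<0::nat} ?M)" by (simp add: space_PiM)
    have ne: "space (IT.C 0 m (\<lambda>_. undefined)) \<noteq> {}"
      using IT.prob_space_C[OF u] prob_space.not_empty by blast
    have "emeasure (IT.C 0 (Suc m) (\<lambda>_. undefined)) {?x (Suc m)} =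
       (\<integral>\<^sup>+\<omega>. emeasure (IT.eP m \<omega>) {?x (Suc m)} \<partial>IT.C 0 m (\<lambda>_. undefined))"
      unfolding IT.C.simps
      using IT.measurable_eP[of m] meas[of "Suc m"] ne
      by (subst emeasure_bind[where N="PiM {0..<Suc m} ?M"])
         (auto simp: measurable_cong_sets[OF IT.sets_C[OF u] refl])
    also have "\<dots> = (\<integral>\<^sup>+\<omega>. emeasure (chain_kernel I K m (?x m)) {x m} * indicator {?x m} \<omega>
                       \<partial>IT.C 0 m (\<lambda>_. undefined))"
    proof (rule nn_integral_cong)
      fix \<omega> assume "\<omega> \<in> space (IT.C 0 m (\<lambda>_. undefined))"
      then have w: "\<omega> \<in> space (PiM {0..<m} ?M)" using IT.space_C[OF u, of m] by simp
      have e: "fun_upd \<omega> m -` {?x (Suc m)} = (if \<omega> = ?x m then {x m} else {})"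
      proof -
        have "fun_upd \<omega> m y = ?x (Suc m) \<longleftrightarrow> \<omega> = ?x m \<and> y = x m" for y
        proof
          assume a: "fun_upd \<omega> m y = ?x (Suc m)"
          have "\<omega> i = ?x m i" for i
            using fun_cong[OF a, of i] w
            by (cases "i < m") (auto simp: space_PiM PiE_iff extensional_def)
          then show "\<omega> = ?x m \<and> y = x m"
            using fun_cong[OF a, of m] by (auto simp: fun_eq_iff)
        next
          assume "\<omega> = ?x m \<and> y = x m"
          then show "fun_upd \<omega> m y = ?x (Suc m)"
            by (auto simp: fun_eq_iff)
        qed
        then show ?thesis by auto
      qed
      show "emeasure (IT.eP m \<omega>) {?x (Suc m)} =
              emeasure (chain_kernel I K m (?x m)) {x m} * indicator {?x m} \<omega>"
        by (subst IT.emeasure_eP[OF w meas]) (auto simp: e)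
    qed
    also have "\<dots> = emeasure (IT.C 0 m (\<lambda>_. undefined)) {?x m} * emeasure (chain_kernel I K m (?x m)) {x m}"
      using meas[of m] IT.sets_C[OF u, of m] by (subst nn_integral_cmult_indicator) (auto simp: mult.commute)
    finally show ?thesis .
  qed
  have C: "emeasure (IT.C 0 (Suc m) (\<lambda>_. undefined)) {?x (Suc m)} =
      ennreal (pmf I (x 0) * (\<Prod>s<m. pmf (K (x s)) (x (Suc s))))" for m
  proof (induction m)
    case 0
    have "emeasure (IT.C 0 0 (\<lambda>_. undefined)) {?x 0} = 1"
      using meas[of 0] by (simp add: restrict_def)
    then show ?case
      unfolding step[of 0] by (simp add: chain_kernel_def emeasure_pmf_single)
  next
    case (Suc m)
    show ?case
      unfolding step[of "Suc m"] Suc.IH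
      by (simp add: chain_kernel_def emeasure_pmf_single ennreal_mult prod_nonneg mult.assoc)
  qed
  have "{\<omega>. \<forall>s\<le>t. \<omega> s = x s} = prod_emb UNIV ?M {0..<Suc t} {?x (Suc t)}"
    by (auto simp: prod_emb_def space_PiM restrict_def fun_eq_iff less_Suc_eq_le) metis
  then have "emeasure (chain_law I K) {\<omega>. \<forall>s\<le>t. \<omega> s = x s} = emeasure (IT.CI {0..<Suc t}) {?x (Suc t)}"
    unfolding chain_law_def using IT.lim[OF _ meas[of "Suc t"]] by simp
  also have "\<dots> = emeasure (IT.C 0 (Suc t) (\<lambda>_. undefined))
      (prod_emb {0..<Suc t} ?M {0..<Suc t} {?x (Suc t)})"
    using meas[of "Suc t"] by (rule IT.emeasure_CI[OF order_refl])
  also have "prod_emb {0..<Suc t} ?M {0..<Suc t} {?x (Suc t)} = {?x (Suc t)}"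
    by (intro prod_emb_id) (auto simp: PiE_iff)
  finally show ?thesis using C by simp
qed


section \<open>The Markov chain choice model\<close>

definition arrival_pmf :: "nat \<Rightarrow> (nat \<Rightarrow> real) \<Rightarrow> nat pmf" where
  "arrival_pmf n lam = embed_pmf (\<lambda>j. if j \<in> {1..n} then lam j else 0)"

definition move_pmf :: "nat \<Rightarrow> (nat \<Rightarrow> nat \<Rightarrow> real) \<Rightarrow> nat \<Rightarrow> nat pmf" where
  "move_pmf n p j = embed_pmf (\<lambda>i. if i \<in> {0..n} then p j i else 0)"

lemma pmf_embed_finite:
  fixes f :: "'a \<Rightarrow> real"
  assumes A: "finite A" and nonneg: "\<And>x. x \<in> A \<Longrightarrow> 0 \<le> f x" and sum: "(\<Sum>x\<in>A. f x) = 1"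
  shows "pmf (embed_pmf (\<lambda>x. if x \<in> A then f x else 0)) y = (if y \<in> A then f y else 0)"
proof (rule pmf_embed_pmf)
  show "0 \<le> (if x \<in> A then f x else 0)" for x
    using nonneg by simp
  have "(\<integral>\<^sup>+x. ennreal (if x \<in> A then f x else 0) \<partial>count_space UNIV) =
          (\<Sum>x\<in>A. ennreal (if x \<in> A then f x else 0))"
    using A by (intro nn_integral_count_space') auto
  also have "\<dots> = ennreal (\<Sum>x\<in>A. f x)"
    using nonneg by (subst sum_ennreal[symmetric]) (auto intro: sum.cong)
  finally show "(\<integral>\<^sup>+x. ennreal (if x \<in> A then f x else 0) \<partial>count_space UNIV) = 1"
    using sum by simp
qed

lemma pmf_arrival_pmf:
  assumes "\<And>j. j \<in> {1..n} \<Longrightarrow> 0 \<le> lam j" and "(\<Sum>j=1..n. lam j) = 1"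
  shows "pmf (arrival_pmf n lam) j = (if j \<in> {1..n} then lam j else 0)"
  unfolding arrival_pmf_def by (rule pmf_embed_finite) (use assms in auto)

lemma pmf_move_pmf:
  assumes "\<And>i. i \<in> {0..n} \<Longrightarrow> 0 \<le> p j i" and "(\<Sum>i=0..n. p j i) = 1"
  shows "pmf (move_pmf n p j) i = (if i \<in> {0..n} then p j i else 0)"
  unfolding move_pmf_def by (rule pmf_embed_finite) (use assms in auto)

text \<open>
  The offered products and \<open>0\<close> are absorbing: the process stops there.
\<close>

definition mc_step :: "nat \<Rightarrow> (nat \<Rightarrow> nat \<Rightarrow> real) \<Rightarrow> nat set \<Rightarrow> nat \<Rightarrow> nat pmf" where
  "mc_step n p S j = (if j \<in> {1..n} - S then move_pmf n p j else return_pmf j)"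

definition mc_purchase_prob ::
    "nat \<Rightarrow> (nat \<Rightarrow> real) \<Rightarrow> (nat \<Rightarrow> nat \<Rightarrow> real) \<Rightarrow> nat set \<Rightarrow> nat \<Rightarrow> real" where
  "mc_purchase_prob n lam p S i =
     measure (chain_law (arrival_pmf n lam) (mc_step n p S)) {\<omega>. i \<in> S \<and> (\<exists>t. \<omega> t = i)}"

definition mc_revenue ::
    "nat \<Rightarrow> (nat \<Rightarrow> real) \<Rightarrow> (nat \<Rightarrow> real) \<Rightarrow> (nat \<Rightarrow> nat \<Rightarrow> real) \<Rightarrow> nat set \<Rightarrow> real" where
  "mc_revenue n lam r p S = (\<Sum>i\<in>S. r i * mc_purchase_prob n lam p S i)"

definition mc_optimal ::
    "nat \<Rightarrow> (nat \<Rightarrow> real) \<Rightarrow> (nat \<Rightarrow> real) \<Rightarrow> (nat \<Rightarrow> nat \<Rightarrow> real) \<Rightarrow> nat set \<Rightarrow> bool" where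
  "mc_optimal n lam r p = is_arg_max (mc_revenue n lam r p) (\<lambda>S. S \<subseteq> {1..n})"

definition mc_optimal_value ::
    "nat \<Rightarrow> (nat \<Rightarrow> real) \<Rightarrow> (nat \<Rightarrow> real) \<Rightarrow> (nat \<Rightarrow> nat \<Rightarrow> real) \<Rightarrow> real" where
  "mc_optimal_value n lam r p = Max (mc_revenue n lam r p ` Pow {1..n})"


section \<open>The homogeneous MCST problem\<close>

text \<open>
  A solution is a pair of an assortment \<open>S\<close> and a family of recommended sets \<open>R j \<subseteq> S\<close>,
  indexed by the products \<open>j\<close> outside \<open>S\<close>.
\<close>

definition mcst_solutions :: "nat \<Rightarrow> (nat set \<times> (nat \<Rightarrow> nat set)) set" where
  "mcst_solutions n = (SIGMA S:Pow {1..n}. ({1..n} - S) \<rightarrow>\<^sub>E Pow S)"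

definition mcst_revenue ::
    "nat \<Rightarrow> (nat \<Rightarrow> real) \<Rightarrow> (nat \<Rightarrow> real) \<Rightarrow> (nat \<Rightarrow> real)
     \<Rightarrow> nat set \<times> (nat \<Rightarrow> nat set) \<Rightarrow> real" where
  "mcst_revenue n lam r v = (\<lambda>(S, R).
     (\<Sum>i\<in>S. lam i * r i) +
     (\<Sum>j\<in>{1..n} - S. lam j * ((\<Sum>i\<in>R j. r i * v i) / ((\<Sum>i\<in>R j. v i) + v 0))))"

definition mcst_optimal ::
    "nat \<Rightarrow> (nat \<Rightarrow> real) \<Rightarrow> (nat \<Rightarrow> real) \<Rightarrow> (nat \<Rightarrow> real)
     \<Rightarrow> nat set \<times> (nat \<Rightarrow> nat set) \<Rightarrow> bool" where
  "mcst_optimal n lam r v = is_arg_max (mcst_revenue n lam r v) (\<lambda>x. x \<in> mcst_solutions n)"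

definition mcst_optimal_value ::
    "nat \<Rightarrow> (nat \<Rightarrow> real) \<Rightarrow> (nat \<Rightarrow> real) \<Rightarrow> (nat \<Rightarrow> real) \<Rightarrow> real" where
  "mcst_optimal_value n lam r v = Max (mcst_revenue n lam r v ` mcst_solutions n)"

end

theory Submission
  imports Defs
begin

text \<open>
  Two facts together give the theorem.

  First, on a common assortment \<open>S\<close> the two models earn the same if in the MCST model
  everything offered is recommended.  With homogeneous weights, a customer who is at a product
  outside \<open>S\<close> moves to a fresh option drawn from \<open>v\<close>, independently of where
  she stands, until the draw falls in \<open>S \<union> {0}\<close>.  If this set has positive weight, the
  last draw is distributed as \<open>v\<close> conditioned on \<open>S \<union> {0}\<close>, which is exactly the
  multinomial logit choice from \<open>S\<close>; otherwise she never buys, in agreement with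
  \<open>0 / 0 = 0\<close>.  Formally, the probability of being at a product outside \<open>S\<close> after
  \<open>t\<close> moves is geometric in \<open>t\<close>, and summing the series gives
  \<open>purchase_prob_eq\<close>.  The event of ever visiting \<open>i\<close> is accessible through
  the one-time marginals because an offered product is absorbing
  (\<open>absorption_prob_limit\<close>).

  Second, restricting the MCST problem to full recommendations loses nothing.  Let \<open>z\<close>
  be the largest multinomial logit revenue of any subset of \<open>S\<close>; it bounds what is earned
  from each customer arriving outside \<open>S\<close>.  Discard from \<open>S\<close> the products with
  revenue below \<open>z\<close>, and recommend all of the remaining set \<open>T\<close>.  A discarded product
  used to earn less than \<open>z\<close> from the customers arriving at it, while recommending
  \<open>T\<close> to them earns at least \<open>z\<close>, since \<open>T\<close> drops only products whose revenue is
  below the optimal average (\<open>mnl_revenue_threshold\<close>).  So the new solution is at least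
  as good (\<open>recommend_all_dominates\<close>).
\<close>

section \<open>Marginals and absorbing states of a Markov chain\<close>

primrec chain_marginal :: "'a pmf \<Rightarrow> ('a \<Rightarrow> 'a pmf) \<Rightarrow> nat \<Rightarrow> 'a pmf" where
  "chain_marginal I K 0 = I"
| "chain_marginal I K (Suc t) = bind_pmf (chain_marginal I K t) K"

lemma measurable_chain_coordinate:
  "(\<lambda>\<omega>. \<omega> t) \<in> chain_law I K \<rightarrow>\<^sub>M count_space UNIV"
  using measurable_component_singleton[of t UNIV "\<lambda>_. count_space UNIV"]
  by (simp add: measurable_cong_sets[OF sets_chain_law refl])

lemma sets_chain_coordinate [measurable]: "{\<omega>. \<omega> t \<in> A} \<in> sets (chain_law I K)"
  using measurable_sets[OF measurable_chain_coordinate, of A t I K]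
  by (simp add: space_chain_law vimage_def)

text \<open>
  Any block of consecutive times behaves like the initial block of the chain restarted from its
  marginal.  The induction sums out the first coordinate of the block, so that the only input is the
  formula for cylinders starting at time \<open>0\<close>.
\<close>

lemma chain_law_window:
  fixes I :: "'a :: countable pmf"
  shows "emeasure (chain_law I K) {\<omega>. \<forall>s\<in>{m..m+t}. \<omega> s = x s} =
    ennreal (pmf (chain_marginal I K m) (x m) * (\<Prod>s<t. pmf (K (x (m+s))) (x (Suc (m+s)))))"
proof (induction m arbitrary: x t)
  case 0
  then show ?case using chain_law_cylinder[of I K t x] by (simp add: Ball_def)
next
  case (Suc m)
  define E where "E y = {\<omega>. \<forall>s\<in>{m..m+Suc t}. \<omega> s = (x(m := y)) s}" for y
  define c where "c = (\<Prod>s<t. pmf (K (x (Suc m+s))) (x (Suc (Suc m+s))))"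
  have c: "0 \<le> c" by (simp add: c_def prod_nonneg)
  have meas: "E y \<in> sets (chain_law I K)" for y
  proof -
    have "E y = (\<Inter>s\<in>{m..m+Suc t}. {\<omega>. \<omega> s \<in> {(x(m := y)) s}})"
      by (auto simp: E_def)
    also have "\<dots> \<in> sets (chain_law I K)"
      by (intro sets.finite_INT sets_chain_coordinate) auto
    finally show ?thesis .
  qed
  have split: "{m..m+Suc t} = insert m {Suc m..Suc m+t}" by auto
  have UN: "{\<omega>. \<forall>s\<in>{Suc m..Suc m+t}. \<omega> s = x s} = (\<Union>y. E y)"
    unfolding E_def split by auto
  have disj: "disjoint_family E"
    unfolding disjoint_family_on_def E_def split by auto
  have E: "emeasure (chain_law I K) (E y) =
      ennreal (pmf (chain_marginal I K m) y) * ennreal (pmf (K y) (x (Suc m))) * ennreal c" for y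
  proof -
    have "emeasure (chain_law I K) (E y) =
      ennreal (pmf (chain_marginal I K m) y * (pmf (K y) (x (Suc m)) * c))"
      unfolding E_def Suc.IH prod.lessThan_Suc_shift by (simp add: c_def)
    then show ?thesis
      using c by (simp add: ennreal_mult mult.assoc)
  qed
  have "emeasure (chain_law I K) {\<omega>. \<forall>s\<in>{Suc m..Suc m+t}. \<omega> s = x s} =
      (\<integral>\<^sup>+y. emeasure (chain_law I K) (E y) \<partial>count_space UNIV)"
    unfolding UN using meas disj by (intro emeasure_UN_countable) auto
  also have "\<dots> = (\<integral>\<^sup>+y. ennreal (pmf (K y) (x (Suc m))) \<partial>chain_marginal I K m) * ennreal c"
    unfolding E by (simp add: nn_integral_multc nn_integral_measure_pmf)
  also have "\<dots> = ennreal (pmf (chain_marginal I K (Suc m)) (x (Suc m)) * c)"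
    using c by (simp add: ennreal_pmf_bind ennreal_mult)
  finally show ?case by (simp add: c_def)
qed

lemma emeasure_chain_marginal:
  fixes I :: "'a :: countable pmf"
  shows "emeasure (chain_law I K) {\<omega>. \<omega> t = a} = ennreal (pmf (chain_marginal I K t) a)"
  using chain_law_window[of I K t 0 "\<lambda>_. a"] by simp

lemma emeasure_chain_transition:
  fixes I :: "'a :: countable pmf"
  shows "emeasure (chain_law I K) {\<omega>. \<omega> t = a \<and> \<omega> (Suc t) = b} =
    ennreal (pmf (chain_marginal I K t) a * pmf (K a) b)"
proof -
  have "{\<omega>. \<omega> t = a \<and> \<omega> (Suc t) = b} =
      {\<omega>. \<forall>s\<in>{t..t+1}. \<omega> s = ((\<lambda>_. b)(t := a)) s}"
    by (auto simp: le_Suc_eq)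
  then show ?thesis using chain_law_window[of I K t 1 "(\<lambda>_. b)(t := a)"] by simp
qed

lemma prob_space_chain_law:
  fixes I :: "'a :: countable pmf"
  shows "prob_space (chain_law I K)"
proof
  have "emeasure (chain_law I K) (\<Union>a. {\<omega>. \<omega> 0 \<in> {a}}) =
      (\<integral>\<^sup>+a. emeasure (chain_law I K) {\<omega>. \<omega> 0 \<in> {a}} \<partial>count_space UNIV)"
    by (intro emeasure_UN_countable sets_chain_coordinate image_subsetI)
       (auto simp: disjoint_family_on_def)
  also have "\<dots> = 1"
    by (simp add: emeasure_chain_marginal nn_integral_pmf measure_pmf.emeasure_space_1[simplified])
  also have "(\<Union>a. {\<omega>. \<omega> 0 \<in> {a}}) = space (chain_law I K)"
    by (auto simp: space_chain_law)
  finally show "emeasure (chain_law I K) (space (chain_law I K)) = 1" .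
qed

text \<open>
  A trajectory may leave an absorbing state, but only on a null set: being there at time
  \<open>t\<close> has the same probability as being there at both \<open>t\<close> and \<open>Suc t\<close>.
\<close>

lemma absorbing_state_stays:
  fixes I :: "'a :: countable pmf"
  assumes "K a = return_pmf a"
  shows "AE \<omega> in chain_law I K. \<forall>s t. s \<le> t \<longrightarrow> \<omega> s = a \<longrightarrow> \<omega> t = a"
proof -
  have "AE \<omega> in chain_law I K. \<omega> t = a \<longrightarrow> \<omega> (Suc t) = a" for t
  proof (rule AE_I)
    let ?A = "{\<omega>. \<omega> t \<in> {a}}" and ?B = "{\<omega>. \<omega> t \<in> {a}} \<inter> {\<omega>. \<omega> (Suc t) \<in> {a}}"
    have "emeasure (chain_law I K) (?A - ?B) =
        emeasure (chain_law I K) ?A - emeasure (chain_law I K) ?B"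
      by (intro emeasure_Diff sets.Int sets_chain_coordinate)
         (auto simp: emeasure_chain_transition Int_def)
    also have "\<dots> = 0"
      by (simp add: emeasure_chain_transition emeasure_chain_marginal Int_def assms)
    finally show "emeasure (chain_law I K) (?A - ?B) = 0" .
    show "?A - ?B \<in> sets (chain_law I K)" by measurable
  qed auto
  then have "AE \<omega> in chain_law I K. \<forall>t. \<omega> t = a \<longrightarrow> \<omega> (Suc t) = a"
    by (simp add: AE_all_countable)
  then show ?thesis
  proof eventually_elim
    case (elim \<omega>)
    have "\<omega> t = a" if "s \<le> t" "\<omega> s = a" for s t
      using that by (induction rule: dec_induct) (use elim in auto)
    then show ?case by blast
  qed
qed

text \<open>
  The events of having visited \<open>a\<close> by time \<open>t\<close> increase to the event of ever
  visiting \<open>a\<close>, and by absorption each agrees almost surely with being at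
  \<open>a\<close> at time \<open>t\<close>.
\<close>

lemma absorption_prob_limit:
  fixes I :: "'a :: countable pmf"
  assumes "K a = return_pmf a"
  shows "(\<lambda>t. pmf (chain_marginal I K t) a) \<longlonglongrightarrow> measure (chain_law I K) {\<omega>. \<exists>t. \<omega> t = a}"
proof -
  interpret prob_space "chain_law I K" by (rule prob_space_chain_law)
  define B where "B t = (\<Union>s\<le>t. {\<omega>. \<omega> s \<in> {a}})" for t :: nat
  have B: "B t \<in> sets (chain_law I K)" for t
    unfolding B_def by (intro sets.finite_UN sets_chain_coordinate) auto
  have "incseq B" unfolding B_def incseq_def by fastforce
  then have "(\<lambda>t. prob (B t)) \<longlonglongrightarrow> prob (\<Union>t. B t)"
    using B by (intro finite_Lim_measure_incseq) auto
  moreover have "(\<Union>t. B t) = {\<omega>. \<exists>t. \<omega> t = a}" by (auto simp: B_def)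
  moreover have "prob (B t) = pmf (chain_marginal I K t) a" for t
  proof -
    have "prob (B t) = prob {\<omega>. \<omega> t \<in> {a}}"
    proof (rule finite_measure_eq_AE)
      show "AE \<omega> in chain_law I K. (\<omega> \<in> B t) = (\<omega> \<in> {\<omega>. \<omega> t \<in> {a}})"
        using absorbing_state_stays[of K a I, OF assms]
        by eventually_elim (auto simp: B_def)
    qed (use B sets_chain_coordinate in blast)+
    then show ?thesis
      by (simp add: measure_def emeasure_chain_marginal)
  qed
  ultimately show ?thesis by simp
qed

section \<open>Purchase probabilities with homogeneous transitions\<close>

locale homogeneous_weights =
  fixes n :: nat and lam v :: "nat \<Rightarrow> real"
  assumes lam_nonneg: "\<And>j. j \<in> {1..n} \<Longrightarrow> 0 \<le> lam j"
    and lam_sum: "(\<Sum>j=1..n. lam j) = 1"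
    and v_nonneg: "\<And>i. i \<in> {0..n} \<Longrightarrow> 0 \<le> v i"
    and v_sum: "(\<Sum>i=0..n. v i) = 1"
begin

text \<open>
  If \<open>L\<close> is the probability of arriving outside \<open>S\<close> and \<open>q\<close> the weight
  of the products outside \<open>S\<close>, the customer is at a product outside \<open>S\<close> after
  \<open>t\<close> moves with probability \<open>L * q ^ t\<close>, and then buys \<open>i\<close> in the next
  move with probability \<open>v i\<close>.  For \<open>q < 1\<close> the geometric series has sum
  \<open>1 / (1 - q)\<close>, and \<open>1 - q\<close> is the weight of \<open>S \<union> {0}\<close>.
\<close>

lemma purchase_prob_eq:
  assumes S: "S \<subseteq> {1..n}" and i: "i \<in> S"
  shows "mc_purchase_prob n lam (\<lambda>j. v) S i =
    lam i + (\<Sum>j\<in>{1..n} - S. lam j) * (v i / ((\<Sum>k\<in>S. v k) + v 0))"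
proof -
  define A where "A = {1..n} - S"
  define L where "L = (\<Sum>j\<in>A. lam j)"
  define q where "q = (\<Sum>j\<in>A. v j)"
  define P where "P = chain_marginal (arrival_pmf n lam) (mc_step n (\<lambda>j. v) S)"
  have fin: "finite A" "finite S" using S finite_subset by (auto simp: A_def)
  have arrival: "pmf (arrival_pmf n lam) k = (if k \<in> {1..n} then lam k else 0)" for k
    by (rule pmf_arrival_pmf) (fact lam_nonneg lam_sum)+
  have step: "pmf (mc_step n (\<lambda>j. v) S y) k = (if y \<in> A then v k else if y = k then 1 else 0)"
    if "k \<in> {1..n}" for y k
    using that pmf_move_pmf[of n "\<lambda>j. v" y k, OF v_nonneg v_sum]
    by (auto simp: mc_step_def A_def)
  have bind: "pmf (P (Suc t)) k = v k * measure (P t) A + (if k \<in> A then 0 else pmf (P t) k)"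
    if k: "k \<in> {1..n}" for t k
  proof -
    have "pmf (P (Suc t)) k = (LINT y|P t. v k * indicator A y + indicator ({k} - A) y)"
      unfolding P_def chain_marginal.simps pmf_bind
      by (intro Bochner_Integration.integral_cong) (auto simp: step[OF k])
    also have "\<dots> = v k * measure (P t) A + measure (P t) ({k} - A)"
      by (subst Bochner_Integration.integral_add) (auto simp: integrable_indicator_iff less_top[symmetric])
    also have "measure (P t) ({k} - A) = (if k \<in> A then 0 else pmf (P t) k)"
      by (cases "k \<in> A") (simp_all add: insert_Diff_if measure_pmf_single)
    finally show ?thesis .
  qed
  have PA: "measure (P t) A = L * q ^ t" for t
  proof (induction t)
    case 0
    then show ?case
      using fin by (auto simp: measure_measure_pmf_finite P_def L_def A_def
          arrival intro!: sum.cong)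
  next
    case (Suc t)
    have "measure (P (Suc t)) A = (\<Sum>k\<in>A. v k * measure (P t) A)"
      using fin by (auto simp: measure_measure_pmf_finite A_def bind intro!: sum.cong)
    then show ?case by (simp add: Suc.IH q_def sum_distrib_right[symmetric])
  qed
  have iN: "i \<in> {1..n}" "i \<notin> A" using S i by (auto simp: A_def)
  have Pi: "pmf (P t) i = lam i + L * v i * (\<Sum>s<t. q ^ s)" for t
  proof (induction t)
    case 0
    then show ?case using iN by (simp add: P_def arrival)
  next
    case (Suc t)
    then show ?case using iN by (simp add: bind PA algebra_simps)
  qed
  have total: "q + ((\<Sum>k\<in>S. v k) + v 0) = 1"
  proof -
    have "(\<Sum>i=0..n. v i) = v 0 + (\<Sum>i=1..n. v i)"
      by (simp add: sum.atLeast_Suc_atMost)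
    moreover have "(\<Sum>i=1..n. v i) = q + (\<Sum>k\<in>S. v k)"
      unfolding q_def A_def using S by (simp add: sum.subset_diff)
    ultimately show ?thesis using v_sum by simp
  qed
  have q0: "0 \<le> q" unfolding q_def A_def by (intro sum_nonneg v_nonneg) auto
  have vi: "0 \<le> v i" "v i \<le> (\<Sum>k\<in>S. v k)" "0 \<le> v 0"
    using S i fin v_nonneg by (auto intro!: member_le_sum)
  have lim: "(\<lambda>t. pmf (P t) i) \<longlonglongrightarrow> lam i + L * (v i / ((\<Sum>k\<in>S. v k) + v 0))"
  proof (cases "q < 1")
    case True
    then have "(\<lambda>t. \<Sum>s<t. q ^ s) \<longlonglongrightarrow> 1 / (1 - q)"
      using geometric_sums[of q] q0 by (simp add: sums_def)
    then have "(\<lambda>t. lam i + L * v i * (\<Sum>s<t. q ^ s)) \<longlonglongrightarrow> lam i + L * v i * (1 / (1 - q))"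
      by (intro tendsto_intros)
    moreover have "1 - q = (\<Sum>k\<in>S. v k) + v 0" using total by simp
    ultimately show ?thesis by (simp add: Pi)
  next
    case False
    \<comment> \<open>All weight lies outside \<open>S \<union> {0}\<close>: a customer arriving outside \<open>S\<close> wanders
      forever, the denominator vanishes, and the convention \<open>0 / 0 = 0\<close> gives the correct value.\<close>
    then have "v i = 0" using total vi by linarith
    then show ?thesis by (simp add: Pi)
  qed
  have "mc_step n (\<lambda>j. v) S i = return_pmf i" using i by (simp add: mc_step_def)
  from absorption_prob_limit[of "mc_step n (\<lambda>j. v) S", OF this, of "arrival_pmf n lam"]
  have "(\<lambda>t. pmf (P t) i) \<longlonglongrightarrow> mc_purchase_prob n lam (\<lambda>j. v) S i"
    using i by (simp add: P_def mc_purchase_prob_def)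
  from LIMSEQ_unique[OF this lim] show ?thesis by (simp add: L_def A_def)
qed

lemma mc_revenue_eq_mcst_revenue:
  assumes S: "S \<subseteq> {1..n}"
  shows "mc_revenue n lam r (\<lambda>j. v) S = mcst_revenue n lam r v (S, \<lambda>j\<in>{1..n} - S. S)"
proof -
  let ?d = "(\<Sum>k\<in>S. v k) + v 0"
  let ?L = "\<Sum>j\<in>{1..n} - S. lam j"
  have "mc_revenue n lam r (\<lambda>j. v) S = (\<Sum>i\<in>S. lam i * r i + ?L * (r i * v i / ?d))"
    unfolding mc_revenue_def
    by (intro sum.cong) (auto simp: purchase_prob_eq[OF S] algebra_simps)
  also have "\<dots> = (\<Sum>i\<in>S. lam i * r i) + ?L * ((\<Sum>i\<in>S. r i * v i) / ?d)"
    by (simp add: sum.distrib sum_distrib_left[symmetric] sum_divide_distrib[symmetric])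
  also have "?L * ((\<Sum>i\<in>S. r i * v i) / ?d) =
      (\<Sum>j\<in>{1..n} - S. lam j * ((\<Sum>i\<in>S. r i * v i) / ?d))"
    by (simp only: sum_distrib_right)
  finally show ?thesis by (simp add: mcst_revenue_def)
qed

end

section \<open>Recommending everything that is offered\<close>

text \<open>
  This is the expected revenue from recommending \<open>R\<close> to a customer who chooses by the
  multinomial logit model; division by zero gives the convention \<open>0 / 0 = 0\<close>.
\<close>

definition mnl_revenue :: "(nat \<Rightarrow> real) \<Rightarrow> (nat \<Rightarrow> real) \<Rightarrow> nat set \<Rightarrow> real" where
  "mnl_revenue r v R = (\<Sum>i\<in>R. r i * v i) / ((\<Sum>i\<in>R. v i) + v 0)"

text \<open>
  With \<open>z = mnl_revenue r v R\<close>, a set \<open>T\<close> whose denominator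
  \<open>(\<Sum>i\<in>T. v i) + v 0\<close> is positive has revenue at least \<open>z\<close> iff its surplus \<open>\<Sum>i\<in>T. v i * (r i - z)\<close> is at least \<open>z * v 0\<close>.
  For \<open>R\<close> equality holds if its denominator is positive, and keeping precisely the products
  of \<open>S\<close> with revenue at least \<open>z\<close> makes the surplus as large as possible.
\<close>

lemma mnl_revenue_threshold:
  assumes S: "finite S" and v: "\<And>i. i \<in> S \<Longrightarrow> 0 \<le> v i" and v0: "0 \<le> v 0"
    and R: "R \<subseteq> S" and nonneg: "0 \<le> mnl_revenue r v R"
  shows "mnl_revenue r v R \<le> mnl_revenue r v {i\<in>S. mnl_revenue r v R \<le> r i}"
proof -
  define z where "z = mnl_revenue r v R"
  define T where "T = {i\<in>S. z \<le> r i}"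
  have fin: "finite R" "finite T" using S R finite_subset by (auto simp: T_def)
  have T: "T \<subseteq> S" by (auto simp: T_def)
  have nnT: "0 \<le> (\<Sum>i\<in>T. v i)" using v T by (intro sum_nonneg) auto
  show ?thesis
  proof (cases "z = 0")
    case True
    then have "0 \<le> mnl_revenue r v T"
      unfolding mnl_revenue_def using v T v0 nnT
      by (intro divide_nonneg_nonneg sum_nonneg mult_nonneg_nonneg) (auto simp: T_def)
    then show ?thesis using True by (simp add: T_def z_def)
  next
    case False
    then have Rden: "(\<Sum>i\<in>R. v i) + v 0 \<noteq> 0"
      by (auto simp: z_def mnl_revenue_def)
    have "z * ((\<Sum>i\<in>R. v i) + v 0) = (\<Sum>i\<in>R. r i * v i)"
      using Rden by (simp add: z_def mnl_revenue_def)
    then have Rgain: "(\<Sum>i\<in>R. v i * (r i - z)) = z * v 0"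
      by (simp add: algebra_simps sum_subtractf sum_distrib_left[symmetric])
    have surplus: "(\<Sum>i\<in>R. v i * (r i - z)) \<le> (\<Sum>i\<in>T. v i * (r i - z))"
    proof -
      have "(\<Sum>i\<in>R. v i * (r i - z)) \<le> (\<Sum>i\<in>R \<inter> T. v i * (r i - z))"
        using fin R v
        by (subst sum.Int_Diff[OF fin(1), of _ T])
           (auto simp: T_def intro!: sum_nonpos mult_nonneg_nonpos)
      also have "\<dots> \<le> (\<Sum>i\<in>T. v i * (r i - z))"
        using fin v by (intro sum_mono2) (auto simp: T_def)
      finally show ?thesis .
    qed
    \<comment> \<open>Without weight in \<open>T\<close> and in \<open>0\<close>, every product of \<open>R\<close> that is ever chosen would
      earn less than the average \<open>z\<close> over \<open>R\<close>.\<close>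
    have "(\<Sum>i\<in>T. v i) + v 0 \<noteq> 0"
    proof
      assume "(\<Sum>i\<in>T. v i) + v 0 = 0"
      then have 0: "v 0 = 0" "(\<Sum>i\<in>T. v i) = 0" using nnT v0 by linarith+
      then have vT: "\<And>i. i \<in> T \<Longrightarrow> v i = 0"
        using fin v T by (subst (asm) sum_nonneg_eq_0_iff) auto
      have "r i * v i \<le> z * v i \<and> (v i \<noteq> 0 \<longrightarrow> r i * v i < z * v i)" if "i \<in> R" for i
        using that vT[of i] v[of i] R
        by (cases "v i = 0") (force simp: T_def not_le subset_iff intro!: mult_strict_right_mono)+
      then have le: "v i * (r i - z) \<le> 0" and lt: "v i \<noteq> 0 \<Longrightarrow> v i * (r i - z) < 0" if "i \<in> R" for i
        using that by (fastforce simp: algebra_simps)+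
      obtain i where "i \<in> R" "v i \<noteq> 0"
        using Rden 0 by (metis add_0_right sum.neutral)
      then have "(\<Sum>i\<in>R. v i * (r i - z)) < (\<Sum>i\<in>R. 0)"
        using fin le lt by (intro sum_strict_mono_ex1) auto
      then show False using Rgain 0 by simp
    qed
    then have "0 < (\<Sum>i\<in>T. v i) + v 0" using nnT v0 by linarith
    moreover have "z * ((\<Sum>i\<in>T. v i) + v 0) \<le> (\<Sum>i\<in>T. r i * v i)"
      using Rgain surplus
      by (simp add: algebra_simps sum_subtractf sum_distrib_left[symmetric])
    ultimately have "z \<le> mnl_revenue r v T"
      by (simp add: mnl_revenue_def pos_le_divide_eq)
    then show ?thesis by (simp add: z_def T_def)
  qed
qed

context homogeneous_weights
begin

text \<open>
  The revenue of each recommended set is replaced by the best value \<open>z\<close> over subsets of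
  \<open>S\<close>, which does not depend on the arrival product.  From then on a product \<open>i\<close> of
  \<open>S\<close> is worth offering to those who arrive at it only if \<open>r i\<close> is at least
  \<open>z\<close>, and the set \<open>T\<close> of those products attains \<open>z\<close> by itself.
\<close>

lemma recommend_all_dominates:
  assumes SR: "(S, R) \<in> mcst_solutions n"
  obtains T where "T \<subseteq> {1..n}"
    and "mcst_revenue n lam r v (S, R) \<le> mcst_revenue n lam r v (T, \<lambda>j\<in>{1..n} - T. T)"
proof -
  let ?N = "{1..n}" and ?f = "mnl_revenue r v"
  have S: "S \<subseteq> ?N" and R: "\<And>j. j \<in> ?N - S \<Longrightarrow> R j \<subseteq> S"
    using SR unfolding mcst_solutions_def by (blast, force simp: PiE_iff)
  have finS: "finite S" using S finite_subset by auto
  define z where "z = Max (?f ` Pow S)"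
  have zmax: "?f Q \<le> z" if "Q \<subseteq> S" for Q
    unfolding z_def using finS that by (intro Max_ge) auto
  have "z \<in> ?f ` Pow S" unfolding z_def using finS by (intro Max_in) auto
  then obtain Q where Q: "Q \<subseteq> S" "?f Q = z" by auto
  \<comment> \<open>Recommending nothing is allowed, so negative revenues never force a negative \<open>z\<close>.\<close>
  have "0 \<le> z" using zmax[of "{}"] by (simp add: mnl_revenue_def)
  define T where "T = {i\<in>S. z \<le> r i}"
  have T: "T \<subseteq> S" by (auto simp: T_def)
  have zT: "z \<le> ?f T"
    using mnl_revenue_threshold[of S v Q r] finS S Q \<open>0 \<le> z\<close> v_nonneg
    by (auto simp: T_def subset_iff)
  have "mcst_revenue n lam r v (S, R) = (\<Sum>i\<in>S. lam i * r i) + (\<Sum>j\<in>?N - S. lam j * ?f (R j))"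
    by (simp add: mcst_revenue_def mnl_revenue_def)
  also have "\<dots> \<le> (\<Sum>i\<in>S. lam i * r i) + (\<Sum>j\<in>?N - S. lam j * z)"
    using R by (intro add_left_mono sum_mono mult_left_mono zmax lam_nonneg) auto
  also have "(\<Sum>i\<in>S. lam i * r i) = (\<Sum>i\<in>S - T. lam i * r i) + (\<Sum>i\<in>T. lam i * r i)"
    using T finS by (intro sum.subset_diff)
  also have "(\<Sum>i\<in>S - T. lam i * r i) \<le> (\<Sum>i\<in>S - T. lam i * z)"
    using S by (intro sum_mono mult_left_mono lam_nonneg) (auto simp: T_def)
  also have "(\<Sum>i\<in>S - T. lam i * z) + (\<Sum>i\<in>T. lam i * r i) + (\<Sum>j\<in>?N - S. lam j * z) =
      (\<Sum>i\<in>T. lam i * r i) + (\<Sum>j\<in>?N - T. lam j * z)"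
  proof -
    have "?N - T = (S - T) \<union> (?N - S)" using S T by auto
    then have "(\<Sum>j\<in>?N - T. lam j * z) = (\<Sum>i\<in>S - T. lam i * z) + (\<Sum>j\<in>?N - S. lam j * z)"
      using finS by (simp only:) (rule sum.union_disjoint, auto)
    then show ?thesis by simp
  qed
  also have "\<dots> \<le> (\<Sum>i\<in>T. lam i * r i) + (\<Sum>j\<in>?N - T. lam j * ?f T)"
    using zT by (intro add_left_mono sum_mono mult_left_mono lam_nonneg) auto
  also have "\<dots> = mcst_revenue n lam r v (T, \<lambda>j\<in>?N - T. T)"
    by (simp add: mcst_revenue_def mnl_revenue_def)
  finally have "mcst_revenue n lam r v (S, R) \<le> mcst_revenue n lam r v (T, \<lambda>j\<in>?N - T. T)"
    by simp
  then show ?thesis using that[of T] S T by auto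
qed

end

theorem theorem1:
  fixes n :: nat and lam r v :: "nat \<Rightarrow> real"
  assumes "\<And>j. j \<in> {1..n} \<Longrightarrow> 0 \<le> lam j"
    and "(\<Sum>j=1..n. lam j) = 1"
    and "antimono_on {1..n} r"
    and "\<And>i. i \<in> {0..n} \<Longrightarrow> 0 \<le> v i"
    and "(\<Sum>i=0..n. v i) = 1"
  shows "(\<forall>S. mc_optimal n lam r (\<lambda>j i. v i) S \<longrightarrow>
              mcst_optimal n lam r v (S, \<lambda>j\<in>{1..n} - S. S)) \<and>
         mcst_optimal_value n lam r v = mc_optimal_value n lam r (\<lambda>j i. v i)"
proof -
  interpret homogeneous_weights n lam v
    using assms by unfold_locales auto
  let ?mc = "mc_revenue n lam r (\<lambda>j. v)" and ?mcst = "mcst_revenue n lam r v"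
  let ?all = "\<lambda>S. (S, \<lambda>j\<in>{1..n} - S. S)"
  have sol: "?all S \<in> mcst_solutions n" if "S \<subseteq> {1..n}" for S
    using that by (auto simp: mcst_solutions_def)
  have finsol: "finite (mcst_solutions n)"
    unfolding mcst_solutions_def by (intro finite_SigmaI finite_PiE) (auto intro: finite_subset)
  have opt: "mcst_optimal n lam r v (?all S)" if "mc_optimal n lam r (\<lambda>j. v) S" for S
  proof -
    have S: "S \<subseteq> {1..n}" and best: "\<And>T. T \<subseteq> {1..n} \<Longrightarrow> ?mc T \<le> ?mc S"
      using that by (auto simp: mc_optimal_def is_arg_max_linorder)
    have "?mcst x \<le> ?mcst (?all S)" if x: "x \<in> mcst_solutions n" for x
    proof -
      obtain T where T: "T \<subseteq> {1..n}" "?mcst x \<le> ?mcst (?all T)"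
        using recommend_all_dominates[of "fst x" "snd x" r] x by auto
      then show ?thesis
        using best[OF T(1)] S T(1) by (simp add: mc_revenue_eq_mcst_revenue)
    qed
    then show ?thesis
      using sol[OF S] by (simp add: mcst_optimal_def is_arg_max_linorder)
  qed
  have "mcst_optimal_value n lam r v = mc_optimal_value n lam r (\<lambda>j. v)"
    unfolding mcst_optimal_value_def mc_optimal_value_def
  proof (rule antisym)
    show "Max (?mcst ` mcst_solutions n) \<le> Max (?mc ` Pow {1..n})"
    proof (rule Max.boundedI)
      fix y assume "y \<in> ?mcst ` mcst_solutions n"
      then obtain S R where SR: "(S, R) \<in> mcst_solutions n" "y = ?mcst (S, R)" by auto
      obtain T where "T \<subseteq> {1..n}" "y \<le> ?mcst (?all T)"
        using recommend_all_dominates[OF SR(1), of r] SR(2) by auto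
      then show "y \<le> Max (?mc ` Pow {1..n})"
        by (intro Max.coboundedI[THEN order_trans[rotated], of _ "?mc T"])
           (auto simp: mc_revenue_eq_mcst_revenue)
    qed (use finsol sol[of "{}"] in auto)
    show "Max (?mc ` Pow {1..n}) \<le> Max (?mcst ` mcst_solutions n)"
      by (intro Max_mono) (use finsol sol in \<open>auto simp: mc_revenue_eq_mcst_revenue\<close>)
  qed
  with opt show ?thesis by blast
qed

end
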